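(* Let $S$ be a finite partially ordered set that contains a $0$ element (a least element), and let $R=R(S)$ be the Redheffer matrix of $S$. Then the permanent of $R$ is the number of chains of $S$ that contain the $0$ element, and $$\det R=\sum_{x\in S}\mu(0,x),$$ where $\mu$ is the Möbius function of $S$.
   Context: Let $(S,\preceq)$ be a finite poset with a least element $0$ (so $0\preceq x$ for all $x\in S$). Suppose the elements of $S$ are labeled by the positive integers $1,\dots,|S|$ in such a way that the $\zeta$-matrix of $S$ (whose $(x,y)$ entry is $1$ if $x\preceq y$ and $0$ otherwise) is upper-triangular; in particular $0$ is labeled first. The Redheffer matrix $R(S)$ is the result of replacing the first column of the $\zeta$-matrix (the column labeled by the $0$ element) by a column of all $1$'s. That is, $R(S)_{x,y}=1$ if $x\preceq y$ or $y=0$, and $R(S)_{x,y}=0$ otherwise. A chain of $S$ is a totally ordered subset of $S$; the one-element chain $\{0\}$ is counted among the chains containing $0$. The Möbius function $\mu$ of $S$ is given by the entries of the inverse of the $\zeta$-matrix: $\mu(x,y)=(\zeta^{-1})_{x,y}$. The permanent of a square matrix $A$ indexed by $S$ is $\sum_\sigma\prod_{x\in S}A_{x,\sigma(x)}$, over all permutations $\sigma$ of $S$. *)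

theory Defs
  imports "Jordan_Normal_Form.Determinant"
begin

text \<open>
  A finite poset is a finite set \<open>S\<close> with a relation \<open>r\<close>, where \<open>(x, y) \<in> r\<close> stands for \<open>x \<preceq> y\<close>.
  Matrices of type \<^typ>\<open>'a mat\<close> are indexed from 0, so a labelling of \<open>S\<close> by \<open>1, \<dots>, |S|\<close> is
  represented by a bijection \<open>lab\<close> from \<open>{..<card S}\<close> to \<open>S\<close>: the element \<open>lab i\<close> carries the
  label \<open>i + 1\<close>.
\<close>

definition zeta_mat :: "'a set \<Rightarrow> 'a rel \<Rightarrow> (nat \<Rightarrow> 'a) \<Rightarrow> int mat" where
  "zeta_mat S r lab =
     mat (card S) (card S) (\<lambda>(i, j). if (lab i, lab j) \<in> r then 1 else 0)"

definition good_labelling :: "'a set \<Rightarrow> 'a rel \<Rightarrow> (nat \<Rightarrow> 'a) \<Rightarrow> bool" where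
  "good_labelling S r lab \<longleftrightarrow>
     bij_betw lab {..<card S} S \<and> upper_triangular (zeta_mat S r lab)"

text \<open>The parameter \<open>z\<close> is the least element of the poset.\<close>

definition redheffer_mat :: "'a set \<Rightarrow> 'a rel \<Rightarrow> 'a \<Rightarrow> (nat \<Rightarrow> 'a) \<Rightarrow> int mat" where
  "redheffer_mat S r z lab =
     mat (card S) (card S) (\<lambda>(i, j). if (lab i, lab j) \<in> r \<or> lab j = z then 1 else 0)"

definition inverse_mat :: "'a::semiring_1 mat \<Rightarrow> 'a mat" where
  "inverse_mat A = (THE B. inverts_mat A B \<and> inverts_mat B A)"

definition moebius :: "'a set \<Rightarrow> 'a rel \<Rightarrow> (nat \<Rightarrow> 'a) \<Rightarrow> 'a \<Rightarrow> 'a \<Rightarrow> int" where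
  "moebius S r lab x y =
     inverse_mat (zeta_mat S r lab) $$
       (inv_into {..<card S} lab x, inv_into {..<card S} lab y)"

definition permanent :: "'a::comm_semiring_1 mat \<Rightarrow> 'a" where
  "permanent A = (\<Sum>p | p permutes {0..<dim_row A}. \<Prod>i = 0..<dim_row A. A $$ (i, p i))"

definition poset_chains :: "'a set \<Rightarrow> 'a rel \<Rightarrow> 'a set set" where
  "poset_chains S r = {C. C \<subseteq> S \<and> total_on C r}"

text \<open>
  The definite description in \<^const>\<open>inverse_mat\<close> determines the two-sided inverse whenever one
  exists; for the zeta matrix one does exist over the integers.
\<close>

lemma inverse_mat_eqI:
  assumes A: "A \<in> carrier_mat n n" and B: "B \<in> carrier_mat n n"
    and AB: "A * B = 1\<^sub>m n" and BA: "B * A = 1\<^sub>m n"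
  shows "inverse_mat A = B"
  unfolding inverse_mat_def
proof (rule the_equality)
  show "inverts_mat A B \<and> inverts_mat B A"
    using assms by (auto simp: inverts_mat_def)
next
  fix C assume C: "inverts_mat A C \<and> inverts_mat C A"
  have AC: "A * C = 1\<^sub>m n" and CA: "C * A = 1\<^sub>m (dim_row C)"
    using C A by (auto simp: inverts_mat_def)
  have "dim_col C = n"
    using arg_cong[OF AC, of dim_col] by simp
  moreover have "dim_row C = n"
    using arg_cong[OF CA, of dim_col] A by simp
  ultimately have Cn: "C \<in> carrier_mat n n" by auto
  have "B = B * (A * C)" using AC B by simp
  also have "\<dots> = (B * A) * C" using A B Cn by (simp add: assoc_mult_mat)
  also have "\<dots> = C" using BA Cn by simp
  finally show "C = B" by simp
qed

lemma inverse_zeta_mat: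
  assumes "partial_order_on S r" and "good_labelling S r lab"
  defines "Z \<equiv> zeta_mat S r lab"
  shows "inverse_mat Z \<in> carrier_mat (card S) (card S)"
    and "Z * inverse_mat Z = 1\<^sub>m (card S)"
    and "inverse_mat Z * Z = 1\<^sub>m (card S)"
proof -
  let ?n = "card S"
  have Z: "Z \<in> carrier_mat ?n ?n" by (simp add: Z_def zeta_mat_def)
  have "Z $$ (i, i) = 1" if "i < ?n" for i
  proof -
    have "lab i \<in> S"
      using assms(2) that by (auto simp: good_labelling_def bij_betw_def)
    then have "(lab i, lab i) \<in> r"
      using partial_order_onD(1)[OF assms(1)] by (simp add: refl_on_def)
    then show ?thesis using that by (simp add: Z_def zeta_mat_def)
  qed
  then have "prod_list (diag_mat Z) = 1"
    using Z by (simp add: prod_list_diag_prod)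
  then have d: "det Z = 1"
    using det_upper_triangular[of Z ?n] Z assms(2) by (simp add: good_labelling_def Z_def)
  have "inverse_mat Z = adj_mat Z"
    by (rule inverse_mat_eqI[OF Z]) (use adj_mat[OF Z] d in auto)
  then show "inverse_mat Z \<in> carrier_mat ?n ?n" "Z * inverse_mat Z = 1\<^sub>m ?n"
    "inverse_mat Z * Z = 1\<^sub>m ?n"
    using adj_mat[OF Z] d by auto
qed

end

theory Submission
  imports Defs
begin

text \<open>
  Let the label of the least element be \<open>0\<close>. A permutation \<open>q\<close> contributes to the permanent of the
  transposed Redheffer matrix iff \<open>q j \<preceq> j\<close> for all \<open>j \<noteq> 0\<close>. Each such \<open>q\<close> has at most one nontrivial
  cycle, which descends step by step through its support and then jumps from \<open>0\<close> to the top; the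
  support together with \<open>0\<close> is a chain, and every chain through \<open>0\<close> arises from exactly one \<open>q\<close>.

  For the determinant, multiplication by the inverse of the zeta matrix \<open>Z\<close> turns all columns but the
  first into unit vectors, and the corner entry becomes \<open>\<Sum>x. \<mu>(0, x)\<close>; finally \<open>det Z = 1\<close>.
\<close>

section \<open>Cyclic descent through a finite set of naturals containing 0\<close>

text \<open>Meant for finite \<open>A\<close> with 0 in it: the inner set is then nonempty for every
  nonzero \<open>j\<close> in \<open>A\<close>, so its \<open>Max\<close> is a true predecessor, and
  sending 0 to \<open>Max A\<close> closes the cycle.\<close>

definition cyclic_pred :: "nat set \<Rightarrow> nat \<Rightarrow> nat" where
  "cyclic_pred A j =
     (if j \<notin> A then j else if j = 0 then Max A else Max {i\<in>A. i < j})"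

lemma cyclic_pred_less:
  assumes "finite A" "0 \<in> A" "j \<in> A" "j \<noteq> 0"
  shows "cyclic_pred A j \<in> A" "cyclic_pred A j < j"
    and "i \<in> A \<Longrightarrow> i < j \<Longrightarrow> i \<le> cyclic_pred A j"
proof -
  have "Max {i\<in>A. i < j} \<in> {i\<in>A. i < j}"
    by (rule Max_in) (use assms in auto)
  then show "cyclic_pred A j \<in> A" "cyclic_pred A j < j"
    using assms by (auto simp: cyclic_pred_def)
  show "i \<in> A \<Longrightarrow> i < j \<Longrightarrow> i \<le> cyclic_pred A j"
    using assms by (simp add: cyclic_pred_def)
qed

text \<open>On a finite set injectivity suffices. For \<open>j < k\<close> in \<open>A\<close>, the
  image of \<open>k\<close> is at least \<open>j\<close>, hence above the image of \<open>j\<close>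
  when \<open>j\<close> is nonzero; for \<open>j = 0\<close> the image of \<open>j\<close> is
  \<open>Max A\<close>, which exceeds that of \<open>k\<close>.\<close>

lemma cyclic_pred_permutes:
  assumes "finite A" "0 \<in> A"
  shows "cyclic_pred A permutes A"
proof (rule bij_imp_permutes)
  have neq: "cyclic_pred A j \<noteq> cyclic_pred A k" if "j \<in> A" "k \<in> A" "j < k" for j k
  proof (cases "j = 0")
    case True
    then have "k \<le> cyclic_pred A j" using that assms by (simp add: cyclic_pred_def)
    then show ?thesis using cyclic_pred_less(2)[OF assms that(2)] that by force
  next
    case False
    then show ?thesis
      using cyclic_pred_less(2)[OF assms that(1)] cyclic_pred_less(3)[OF assms that(2), of j] that
      by force
  qed
  have "inj_on (cyclic_pred A) A"
    by (rule linorder_inj_onI) (use neq in auto)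
  moreover have "cyclic_pred A ` A \<subseteq> A"
    using cyclic_pred_less(1)[OF assms] Max_in[OF assms(1)] assms(2)
    by (force simp: cyclic_pred_def)
  ultimately show "bij_betw (cyclic_pred A) A A"
    using assms(1) by (simp add: bij_betw_def endo_inj_surj)
qed (simp add: cyclic_pred_def)

text \<open>Recovers the set from its permutation. Inserting 0 covers \<open>A = {0}\<close>, where
  the permutation is the identity and moves nothing.\<close>

lemma support_cyclic_pred:
  assumes "finite A" "0 \<in> A"
  shows "insert 0 {j. cyclic_pred A j \<noteq> j} = A"
proof -
  have "cyclic_pred A j \<noteq> j" if "j \<in> A" "j \<noteq> 0" for j
    using cyclic_pred_less(2)[OF assms that] by simp
  moreover have "cyclic_pred A j = j" if "j \<notin> A" for j
    using that by (simp add: cyclic_pred_def)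
  ultimately show ?thesis using assms(2) by auto
qed

text \<open>A nonzero point that is not fixed moves strictly down. If it skipped an element of the
  support, a smaller point would already be forced onto the same image, against injectivity. So the
  support determines the permutation.\<close>

lemma decreasing_permutation_eq_cyclic_pred:
  assumes q: "q permutes {0..<n}" and n: "0 < n"
    and le: "\<And>j. j < n \<Longrightarrow> j \<noteq> 0 \<Longrightarrow> q j \<le> j"
  shows "q = cyclic_pred (insert 0 {j. q j \<noteq> j})"
proof -
  define A where "A = insert 0 {j. q j \<noteq> j}"
  have An: "A \<subseteq> {0..<n}"
    using n permutes_not_in[OF q] by (fastforce simp: A_def)
  then have fin: "finite A" by (rule finite_subset) simp
  have zero: "0 \<in> A" by (simp add: A_def)
  have inj: "inj q" by (rule permutes_inj[OF q])
  have step: "q j = cyclic_pred A j" if "j \<in> A" "j \<noteq> 0" for j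
    using that
  proof (induction j rule: less_induct)
    case (less j)
    note pred = cyclic_pred_less[OF fin zero less.prems]
    have "q j \<noteq> j" using less.prems by (auto simp: A_def)
    \<comment> \<open>\<open>q j\<close> is not fixed either: \<open>q (q j) = q j\<close> would
      give \<open>q j = j\<close> by injectivity.\<close>
    moreover from this have qA: "q j \<in> A"
      using inj by (auto simp: A_def dest: injD)
    ultimately have qj: "q j < j"
      using le[of j] less.prems An by force
    show ?case
    proof (rule ccontr)
      assume "q j \<noteq> cyclic_pred A j"
      then have lt: "q j < cyclic_pred A j"
        using pred(3)[OF qA qj] by simp
      \<comment> \<open>\<open>k\<close> is the immediate successor of \<open>q j\<close> in
        \<open>A\<close>. It is at most the predecessor of \<open>j\<close>, hence below
        \<open>j\<close>, and the induction hypothesis gives it the image \<open>q j\<close> as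
        well.\<close>
      define k where "k = Min {k\<in>A. q j < k}"
      have "k \<in> {k\<in>A. q j < k}"
        unfolding k_def by (rule Min_in) (use fin pred(1) lt in auto)
      then have k: "k \<in> A" "q j < k" by auto
      have kmin: "k \<le> i" if "i \<in> A" "q j < i" for i
        unfolding k_def by (rule Min_le) (use fin that in auto)
      have kj: "k < j" using kmin[OF pred(1) lt] pred(2) by simp
      have k0: "k \<noteq> 0" using k(2) by simp
      note predk = cyclic_pred_less[OF fin zero k(1) k0]
      have "cyclic_pred A k = q j"
      proof (rule antisym)
        show "cyclic_pred A k \<le> q j"
          using kmin[OF predk(1)] predk(2) by force
      qed (rule predk(3)[OF qA k(2)])
      then have "q k = q j" using less.IH[OF kj k(1) k0] by simp
      then show False using inj kj by (auto dest: injD)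
    qed
  qed
  have agree: "q j = cyclic_pred A j" if "j \<noteq> 0" for j
    using step[of j] that by (cases "j \<in> A") (auto simp: A_def cyclic_pred_def)
  obtain y where y: "cyclic_pred A y = q 0"
    using permutes_surj[OF cyclic_pred_permutes[OF fin zero]] by (metis surjD)
  \<comment> \<open>A nonzero \<open>y\<close> would satisfy \<open>q y = q 0\<close> by
    \<open>agree\<close>. So the value at 0 is forced by the values elsewhere.\<close>
  have "y = 0" using agree[of y] y inj by (metis injD)
  then have "q 0 = cyclic_pred A 0" using y by simp
  then show ?thesis using agree by (metis A_def ext)
qed

text \<open>The bijection takes \<open>q\<close> to its support with 0 added, with inverse
  \<open>cyclic_pred\<close>. \<open>E\<close> stands for the poset order read on labels; since
  \<open>E i j\<close> implies \<open>i \<le> j\<close>, being a chain amounts to \<open>E\<close>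
  holding along \<open>\<le>\<close>.\<close>

lemma card_decreasing_permutations:
  fixes E :: "nat \<Rightarrow> nat \<Rightarrow> bool"
  assumes n: "0 < n"
    and refl: "\<And>i. i < n \<Longrightarrow> E i i"
    and trans: "\<And>i j k. E i j \<Longrightarrow> E j k \<Longrightarrow> E i k"
    and le: "\<And>i j. i < n \<Longrightarrow> j < n \<Longrightarrow> E i j \<Longrightarrow> i \<le> j"
  shows "card {q. q permutes {0..<n} \<and> (\<forall>j<n. j = 0 \<or> E (q j) j)} =
         card {A. A \<subseteq> {0..<n} \<and> 0 \<in> A \<and> (\<forall>i\<in>A. \<forall>j\<in>A. i \<le> j \<longrightarrow> E i j)}"
    (is "card ?Q = card ?C")
proof (rule bij_betw_same_card[OF bij_betw_byWitness[where f' = cyclic_pred]])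
  let ?f = "\<lambda>q. insert 0 {j::nat. q j \<noteq> j}"
  have rep: "q = cyclic_pred (?f q)" if "q \<in> ?Q" for q
  proof (rule decreasing_permutation_eq_cyclic_pred[OF _ n])
    show q: "q permutes {0..<n}" using that by simp
    fix j assume "j < n" "j \<noteq> 0"
    moreover from \<open>j < n\<close> have "q j < n" using permutes_in_image[OF q, of j] by simp
    ultimately show "q j \<le> j" using that le by blast
  qed
  show "\<forall>q\<in>?Q. cyclic_pred (?f q) = q" by (intro ballI rep[symmetric])
  have fin: "finite A" if "A \<subseteq> {0..<n}" for A
    using that by (rule finite_subset) simp
  then show "\<forall>A\<in>?C. ?f (cyclic_pred A) = A"
    by (simp add: support_cyclic_pred)
  show "?f ` ?Q \<subseteq> ?C"
  proof (rule image_subsetI)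
    fix q assume qQ: "q \<in> ?Q"
    define A where "A = ?f q"
    have q: "q = cyclic_pred A" using rep[OF qQ] by (simp add: A_def)
    have perm: "q permutes {0..<n}" using qQ by simp
    have An: "A \<subseteq> {0..<n}"
      using n permutes_not_in[OF perm] by (fastforce simp: A_def)
    have zero: "0 \<in> A" by (simp add: A_def)
    \<comment> \<open>Induction up the set: an \<open>i\<close> in \<open>A\<close> below
      \<open>j\<close> is at most the predecessor \<open>q j\<close>, so \<open>E i (q j)\<close>
      holds by induction, \<open>E (q j) j\<close> holds by the choice of \<open>q\<close>, and
      transitivity joins them.\<close>
    have "\<forall>i\<in>A. i \<le> j \<longrightarrow> E i j" if "j \<in> A" for j
      using that
    proof (induction j rule: less_induct)
      case (less j)
      show ?case
      proof (intro ballI impI)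
        fix i assume i: "i \<in> A" "i \<le> j"
        have jn: "j < n" using less.prems An by auto
        show "E i j"
        proof (cases "i = j")
          case True
          then show ?thesis using refl jn by simp
        next
          case False
          then have j0: "j \<noteq> 0" and ij: "i < j" using i by auto
          note pred = cyclic_pred_less[OF fin[OF An] zero less.prems j0, folded q]
          have "E (q j) j" using qQ jn j0 by auto
          moreover have "E i (q j)"
            using less.IH[OF pred(2) pred(1)] pred(3)[OF i(1) ij] i(1) by blast
          ultimately show ?thesis by (rule trans[rotated])
        qed
      qed
    qed
    then show "?f q \<in> ?C" using An zero unfolding A_def by blast
  qed
  show "cyclic_pred ` ?C \<subseteq> ?Q"
  proof (rule image_subsetI)
    fix A assume A: "A \<in> ?C"
    then have finA: "finite A" and zero: "0 \<in> A" using fin by auto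
    have "cyclic_pred A permutes {0..<n}"
      by (rule permutes_subset[OF cyclic_pred_permutes[OF finA zero]]) (use A in auto)
    moreover have "E (cyclic_pred A j) j" if "j < n" "j \<noteq> 0" for j
    proof (cases "j \<in> A")
      case True
      then show ?thesis
        using A cyclic_pred_less(1,2)[OF finA zero True that(2)] by force
    next
      case False
      then show ?thesis using refl that by (simp add: cyclic_pred_def)
    qed
    ultimately show "cyclic_pred A \<in> ?Q" by blast
  qed
qed

section \<open>Permanents of 0/1 matrices as counts of permutations\<close>

text \<open>Summing over inverse permutations makes the column the free index, so that an all-ones
  column 0 just leaves the value of the permutation at 0 unconstrained.\<close>

lemma permanent_transpose:
  fixes A :: "'a::comm_semiring_1 mat"
  assumes "A \<in> carrier_mat n n"
  shows "permanent A = (\<Sum>p | p permutes {0..<n}. \<Prod>i = 0..<n. A $$ (p i, i))"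
proof -
  have "permanent A = (\<Sum>p | p permutes {0..<n}. \<Prod>i = 0..<n. A $$ (i, p i))"
    using assms by (simp add: permanent_def)
  also have "\<dots> = (\<Sum>p | p permutes {0..<n}. \<Prod>i = 0..<n. A $$ (i, Hilbert_Choice.inv p i))"
    by (rule sum_permutations_inverse)
  also have "\<dots> = (\<Sum>p | p permutes {0..<n}. \<Prod>i = 0..<n. A $$ (p i, i))"
  proof (rule sum.cong[OF HOL.refl])
    fix p assume "p \<in> {p. p permutes {0..<n}}"
    then have p: "p permutes {0..<n}" by simp
    have "(\<Prod>i = 0..<n. A $$ (i, Hilbert_Choice.inv p i)) = (\<Prod>i = 0..<n. A $$ (p i, Hilbert_Choice.inv p (p i)))"
      using prod.permute[OF p, of "\<lambda>i. A $$ (i, Hilbert_Choice.inv p i)"] by (simp add: o_def)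
    then show "(\<Prod>i = 0..<n. A $$ (i, Hilbert_Choice.inv p i)) = (\<Prod>i = 0..<n. A $$ (p i, i))"
      by (simp add: permutes_inverses(2)[OF p])
  qed
  finally show ?thesis .
qed

lemma permanent_indicator:
  fixes A :: "'a::comm_semiring_1 mat"
  assumes "A \<in> carrier_mat n n"
    and "\<And>i j. i < n \<Longrightarrow> j < n \<Longrightarrow> A $$ (i, j) = (if P i j then 1 else 0)"
  shows "permanent A = of_nat (card {p. p permutes {0..<n} \<and> (\<forall>j<n. P (p j) j)})"
proof -
  have "(\<Prod>j = 0..<n. A $$ (p j, j)) = (if \<forall>j<n. P (p j) j then 1 else 0)"
    if "p permutes {0..<n}" for p
  proof -
    have "(\<Prod>j = 0..<n. A $$ (p j, j)) = (\<Prod>j = 0..<n. if P (p j) j then 1 else 0)"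
      using permutes_in_image[OF that] assms(2) by (intro prod.cong) auto
    also have "\<dots> = (if \<forall>j<n. P (p j) j then 1 else 0)"
    proof (cases "\<forall>j<n. P (p j) j")
      case False
      then obtain j where "j < n" "\<not> P (p j) j" by blast
      then show ?thesis using False
        by (auto intro!: prod_zero bexI[of _ j])
    qed simp
    finally show ?thesis .
  qed
  then have "permanent A =
      (\<Sum>p | p permutes {0..<n}. if \<forall>j<n. P (p j) j then 1 else 0)"
    by (simp add: permanent_transpose[OF assms(1)])
  also have "\<dots> = of_nat (card {p. p permutes {0..<n} \<and> (\<forall>j<n. P (p j) j)})"
    by (simp add: finite_permutations flip: sum.inter_filter)
  finally show ?thesis .
qed

section \<open>Labellings and the zeta matrix\<close>

lemma good_labelling_le:
  assumes "good_labelling S r lab" "i < card S" "j < card S" "(lab i, lab j) \<in> r"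
  shows "i \<le> j"
proof (rule ccontr)
  assume "\<not> i \<le> j"
  then have "zeta_mat S r lab $$ (i, j) = 0"
    using assms(1,2) by (intro upper_triangularD) (auto simp: good_labelling_def zeta_mat_def)
  then show False using assms by (simp add: zeta_mat_def)
qed

text \<open>The least element lies below \<open>lab 0\<close>, so upper triangularity bounds its own
  index by 0.\<close>

lemma good_labelling_least:
  assumes "finite S" "z \<in> S" "\<forall>x\<in>S. (z, x) \<in> r" "good_labelling S r lab"
  shows "lab 0 = z"
proof -
  have bij: "bij_betw lab {..<card S} S" using assms(4) by (simp add: good_labelling_def)
  then obtain k where k: "k < card S" "lab k = z"
    using assms(2) by (metis bij_betwE bij_betw_iff_bijections lessThan_iff)
  then have "lab 0 \<in> S" using bij by (auto simp: bij_betw_def)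
  then have "k \<le> 0"
    using good_labelling_le[OF assms(4) k(1), of 0] k assms(3) by auto
  then show ?thesis using k by simp
qed

lemma det_zeta_mat:
  assumes "partial_order_on S r" "good_labelling S r lab"
  shows "det (zeta_mat S r lab) = 1"
proof -
  let ?Z = "zeta_mat S r lab"
  have Z: "?Z \<in> carrier_mat (card S) (card S)" by (simp add: zeta_mat_def)
  have "?Z $$ (i, i) = 1" if "i < card S" for i
  proof -
    have "lab i \<in> S"
      using assms(2) that by (auto simp: good_labelling_def bij_betw_def)
    then show ?thesis
      using that partial_order_onD(1)[OF assms(1)] by (simp add: zeta_mat_def refl_on_def)
  qed
  then show ?thesis
    using det_upper_triangular[of ?Z "card S"] Z assms(2)
    by (simp add: good_labelling_def prod_list_diag_prod)
qed

section \<open>The permanent\<close>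

lemma permanent_redheffer_mat:
  assumes S: "finite S" and po: "partial_order_on S r" and z: "z \<in> S"
    and least: "\<forall>x\<in>S. (z, x) \<in> r" and gl: "good_labelling S r lab"
  shows "permanent (redheffer_mat S r z lab) = int (card {C \<in> poset_chains S r. z \<in> C})"
proof -
  let ?n = "card S"
  define E where "E i j \<longleftrightarrow> (lab i, lab j) \<in> r" for i j
  have bij: "bij_betw lab {0..<?n} S"
    using gl by (simp add: good_labelling_def atLeast0LessThan)
  then have inj: "inj_on lab {0..<?n}" and img: "lab ` {0..<?n} = S"
    by (auto simp: bij_betw_def)
  have n: "0 < ?n" using S z card_gt_0_iff by blast
  have lab0: "lab 0 = z" by (rule good_labelling_least[OF S z least gl])
  have labz: "lab j = z \<longleftrightarrow> j = 0" if "j < ?n" for j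
    using inj_onD[OF inj, of j 0] that n lab0 by auto
  have refl: "(x, x) \<in> r" if "x \<in> S" for x
    using partial_order_onD(1)[OF po] that by (simp add: refl_on_def)
  have transr: "trans r" using po by (rule partial_order_onD(2))
  have le: "i \<le> j" if "i < ?n" "j < ?n" "E i j" for i j
    using good_labelling_le[OF gl that(1,2)] that(3) by (simp add: E_def)
  let ?C = "{A. A \<subseteq> {0..<?n} \<and> 0 \<in> A \<and> (\<forall>i\<in>A. \<forall>j\<in>A. i \<le> j \<longrightarrow> E i j)}"
  \<comment> \<open>By \<open>labz\<close> the disjunct \<open>j = 0\<close> is exactly the all-ones
    column.\<close>
  have "permanent (redheffer_mat S r z lab) =
      int (card {q. q permutes {0..<?n} \<and> (\<forall>j<?n. j = 0 \<or> E (q j) j)})"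
    by (rule permanent_indicator) (auto simp: redheffer_mat_def E_def labz)
  also have "card {q. q permutes {0..<?n} \<and> (\<forall>j<?n. j = 0 \<or> E (q j) j)} = card ?C"
  proof (rule card_decreasing_permutations[OF n])
    show "E i i" if "i < ?n" for i
      using bij_betwE[OF bij] refl that by (simp add: E_def)
    show "E i k" if "E i j" "E j k" for i j k
      using that transr unfolding E_def by (rule transD[rotated])
  qed (rule le)
  also have "\<dots> = card ((`) lab ` ?C)"
    by (rule card_image[symmetric], rule inj_on_subset[OF inj_on_image_Pow[OF inj]]) auto
  also have "(`) lab ` ?C = {C \<in> poset_chains S r. z \<in> C}"
  proof (intro equalityI subsetI)
    fix C assume "C \<in> (`) lab ` ?C"
    then obtain A where A: "A \<in> ?C" and C: "C = lab ` A" by blast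
    have "total_on C r"
      unfolding total_on_def C
    proof (intro ballI impI)
      fix x y assume "x \<in> lab ` A" "y \<in> lab ` A"
      then obtain i j where "i \<in> A" "x = lab i" "j \<in> A" "y = lab j" by blast
      then show "(x, y) \<in> r \<or> (y, x) \<in> r"
        using A linear[of i j] by (auto simp: E_def)
    qed
    moreover have "C \<subseteq> S" "z \<in> C" using A img lab0 by (auto simp: C)
    ultimately show "C \<in> {C \<in> poset_chains S r. z \<in> C}" by (simp add: poset_chains_def)
  next
    fix C assume "C \<in> {C \<in> poset_chains S r. z \<in> C}"
    then have C: "C \<subseteq> S" "total_on C r" "z \<in> C" by (auto simp: poset_chains_def)
    define A where "A = {i \<in> {0..<?n}. lab i \<in> C}"
    have "E i j" if "i \<in> A" "j \<in> A" "i \<le> j" for i j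
    proof (cases "lab i = lab j")
      case True
      then show ?thesis using refl that C by (auto simp: E_def A_def)
    next
      case False
      then have "E i j \<or> E j i"
        using that C(2) by (auto simp: E_def A_def total_on_def)
      \<comment> \<open>Comparability in the wrong direction gives \<open>j \<le> i\<close>, hence
        equal indices, which the case excludes.\<close>
      moreover have "i = j" if "E j i"
        using le[of j i] that \<open>i \<in> A\<close> \<open>j \<in> A\<close> \<open>i \<le> j\<close> by (auto simp: A_def)
      ultimately show ?thesis using False by blast
    qed
    moreover have "0 \<in> A" using n lab0 C(3) by (simp add: A_def)
    ultimately have "A \<in> ?C" by (auto simp: A_def)
    moreover have "C \<subseteq> lab ` {0..<?n}" using C(1) img by simp
    then have "C = lab ` A" unfolding A_def by blast
    ultimately show "C \<in> (`) lab ` ?C" by blast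
  qed
  finally show ?thesis .
qed

section \<open>The determinant\<close>

lemma det_redheffer_mat:
  assumes S: "finite S" and po: "partial_order_on S r" and z: "z \<in> S"
    and least: "\<forall>x\<in>S. (z, x) \<in> r" and gl: "good_labelling S r lab"
  shows "det (redheffer_mat S r z lab) = (\<Sum>x\<in>S. moebius S r lab z x)"
proof -
  let ?n = "card S"
  define Z where "Z = zeta_mat S r lab"
  define M where "M = inverse_mat Z"
  define R where "R = redheffer_mat S r z lab"
  have Z: "Z \<in> carrier_mat ?n ?n" by (simp add: Z_def zeta_mat_def)
  have R: "R \<in> carrier_mat ?n ?n" by (simp add: R_def redheffer_mat_def)
  have M: "M \<in> carrier_mat ?n ?n" and ZM: "Z * M = 1\<^sub>m ?n" and MZ: "M * Z = 1\<^sub>m ?n"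
    using inverse_zeta_mat[OF po gl] by (auto simp: M_def Z_def)
  have bij: "bij_betw lab {..<?n} S" using gl by (simp add: good_labelling_def)
  then have inj: "inj_on lab {..<?n}" by (rule bij_betw_imp_inj_on)
  have n: "0 < ?n" using S z card_gt_0_iff by blast
  have lab0: "lab 0 = z" by (rule good_labelling_least[OF S z least gl])
  have labz: "lab j = z \<longleftrightarrow> j = 0" if "j < ?n" for j
    using inj_onD[OF inj, of j 0] that n lab0 by auto
  \<comment> \<open>The matrices can differ only in column 0, so off it \<open>M * R\<close> agrees
    with \<open>M * Z\<close>, the identity.\<close>
  have colR: "col R j = col Z j" if "j < ?n" "j \<noteq> 0" for j
    using that labz by (intro eq_vecI) (auto simp: R_def Z_def redheffer_mat_def zeta_mat_def)
  have MR: "(M * R) $$ (i, j) = (if i = j then 1 else 0)" if "i < ?n" "j < ?n" "j \<noteq> 0" for i j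
  proof -
    have "(M * R) $$ (i, j) = (M * Z) $$ (i, j)"
      using that M R Z colR by simp
    then show ?thesis using MZ that by simp
  qed
  \<comment> \<open>Column 0 of \<open>R\<close> is all ones because \<open>lab 0 = z\<close>, so
    the corner sums row 0 of \<open>M\<close>.\<close>
  have corner: "(M * R) $$ (0, 0) = (\<Sum>k<?n. M $$ (0, k))"
    using n M lab0
    by (simp add: R_def redheffer_mat_def scalar_prod_def atLeast0LessThan)
  have MRc: "M * R \<in> carrier_mat ?n ?n" using M R by simp
  \<comment> \<open>Being the identity outside column 0, the product is lower triangular, and only
    the corner survives in its diagonal product.\<close>
  have "det (M * R) = prod_list (diag_mat (M * R))"
    by (rule det_lower_triangular[OF _ MRc]) (simp add: MR)
  also have "\<dots> = (\<Prod>i = 0..<?n. (M * R) $$ (i, i))"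
    using R M by (simp add: prod_list_diag_prod)
  also have "\<dots> = (M * R) $$ (0, 0) * (\<Prod>i = Suc 0..<?n. (M * R) $$ (i, i))"
    using n by (rule prod.atLeast_Suc_lessThan)
  also have "(\<Prod>i = Suc 0..<?n. (M * R) $$ (i, i)) = 1"
    by (rule prod.neutral) (simp add: MR)
  finally have det_MR: "det (M * R) = (\<Sum>k<?n. M $$ (0, k))"
    using corner by simp
  have "det Z * det M = 1"
    using det_mult[OF Z M] ZM by simp
  then have "det M = 1"
    using det_zeta_mat[OF po gl] by (simp add: Z_def)
  then have "det R = (\<Sum>k<?n. M $$ (0, k))"
    using det_MR det_mult[OF M R] by simp
  also have "\<dots> = (\<Sum>k<?n. moebius S r lab z (lab k))"
  proof (rule sum.cong[OF HOL.refl])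
    fix k assume "k \<in> {..<?n}"
    moreover have "inv_into {..<?n} lab z = 0"
      using inv_into_f_f[OF inj, of 0] n lab0 by simp
    ultimately show "M $$ (0, k) = moebius S r lab z (lab k)"
      by (simp add: moebius_def M_def Z_def inv_into_f_f[OF inj])
  qed
  also have "\<dots> = (\<Sum>x\<in>S. moebius S r lab z x)"
    by (rule sum.reindex_bij_betw[OF bij])
  finally show ?thesis by (simp add: R_def)
qed

theorem theorem2:
  fixes S :: "'a set" and r :: "'a rel" and z :: 'a and lab :: "nat \<Rightarrow> 'a"
  assumes "finite S"
    and "partial_order_on S r"
    and "z \<in> S"
    and "\<forall>x\<in>S. (z, x) \<in> r"
    and "good_labelling S r lab"
  shows "permanent (redheffer_mat S r z lab) = int (card {C \<in> poset_chains S r. z \<in> C}) \<and>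
         det (redheffer_mat S r z lab) = (\<Sum>x\<in>S. moebius S r lab z x)"
  using permanent_redheffer_mat[OF assms] det_redheffer_mat[OF assms] by blast

end
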